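(* Consider the exponential decay change-point model. If the link function $\widetilde\Psi$ is continuous and the spectral radius satisfies $\rho(\mathbb G)<1$, then for any block $\Xi\in[K]^\ell$ and any $\epsilon>0$ there exists a positive integer $M(\Xi,\epsilon)$ such that for any $M\ge M(\Xi,\epsilon)$ $$\sup_{t\ge0,\,z\in[K]^t,\,j\in[\ell]}\Big|\frac1M\sum_{s=1}^M\omega\big(\pi_{t+s}(z,\Xi(j:s+j-1))\big)-d(\Xi)\Big|\le\epsilon,\qquad d(\Xi)=\frac1\ell\sum_{j=1}^\ell\omega\big(\widetilde\Psi(\chi_j[1])\big),$$ where $\omega(x)=|\log(1-x)|$, $\chi_j[1]$ is the first coordinate of $\chi_j$ and $$\chi_j=(\mathbb I-\mathbb G^\ell)^{-1}\sum_{i=j-\ell+1}^j\mathbb G^{j-i}\mathbb Q(\Xi(i)),\qquad1\le j\le\ell.$$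
   Context: Fix $K\ge2$, $[K]=\{1,\dots,K\}$. In the change-point model, $\pi_t(x_1,\dots,x_t)\in[0,1)$ is the conditional probability that the change occurs at time $t$, given that it has not occurred before and that treatments $x_1,\dots,x_t\in[K]$ have been assigned. Exponential decay model: $\pi_t(x_1,\dots,x_t)=\widetilde\Psi(\xi_t)$, $\xi_t=\sum_{i=1}^\kappa r_i\xi_{t-i}+q_{x_t}$, $t\ge1$, where $\kappa\ge1$, $\widetilde\Psi:\mathbb R\to[0,1)$, $r_i\in[0,1]$, $q_x\ge0$, and the initial values $\xi_0,\dots,\xi_{1-\kappa}$ are fixed. $\mathbb G$ is the $\kappa\times\kappa$ companion matrix with first row $(r_1,\dots,r_\kappa)$, ones on the subdiagonal (entries $(i+1,i)$), zeros elsewhere; $\mathbb Q(x)=(q_x,0,\dots,0)^\top\in\mathbb R^\kappa$; $\mathbb I$ is the identity; $\rho(\mathbb G)$ the spectral radius. A block $\Xi\in[K]^\ell$ is extended cyclically: $\Xi(m\ell+i)=\Xi(i)$ for every integer $m$, $1\le i\le\ell$; $\Xi(i:j)=(\Xi(i),\dots,\Xi(j))$. In $\pi_{t+s}(z,\Xi(j:s+j-1))$ the first $t$ treatments are $z$ and the next $s$ are $\Xi(j),\dots,\Xi(s+j-1)$. *)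

theory Defs
  imports Complex_Main "HOL-Library.Extended_Real" "Jordan_Normal_Form.Spectral_Radius"
begin

text \<open>Treatments are the naturals \<open>1, \<dots>, K\<close>; a tuple of treatments \<open>(x\<^sub>1, \<dots>, x\<^sub>t)\<close> is a list, so that
  \<open>x\<^sub>i\<close> is \<open>xs ! (i - 1)\<close>.\<close>

definition treatments :: "nat \<Rightarrow> nat \<Rightarrow> nat list set" where
  "treatments K t = {xs. length xs = t \<and> set xs \<subseteq> {1..K}}"

text \<open>The integer-indexed recursion for \<open>\<xi>\<close>. The initial values at times \<open>0, \<dots>, 1 - \<kappa>\<close> are
  given by \<open>init\<close>; no other values of \<open>init\<close> enter \<open>\<xi>\<close> at positive times, and
  for \<open>1 \<le> t \<le> length xs\<close> the value at time \<open>t\<close> depends only on the first \<open>t\<close> treatments.\<close>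

function xi :: "nat \<Rightarrow> (nat \<Rightarrow> real) \<Rightarrow> (nat \<Rightarrow> real) \<Rightarrow> (int \<Rightarrow> real) \<Rightarrow> nat list \<Rightarrow> int \<Rightarrow> real" where
  "xi \<kappa> r q init xs t =
     (if t \<le> 0 then init t
      else (\<Sum>i = 1..\<kappa>. r i * xi \<kappa> r q init xs (t - int i)) + q (xs ! (nat t - 1)))"
  by pat_completeness auto
termination
  by (relation "Wellfounded.measure (\<lambda>(\<kappa>, r, q, init, xs, t). nat t)") auto

declare xi.simps [simp del]

text \<open>\<open>change_prob \<dots> [x\<^sub>1, \<dots>, x\<^sub>t]\<close> is \<open>\<pi>\<^sub>t(x\<^sub>1, \<dots>, x\<^sub>t)\<close>; the time \<open>t\<close> is the length of the list.\<close>

definition change_prob ::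
  "(real \<Rightarrow> real) \<Rightarrow> nat \<Rightarrow> (nat \<Rightarrow> real) \<Rightarrow> (nat \<Rightarrow> real) \<Rightarrow> (int \<Rightarrow> real) \<Rightarrow> nat list \<Rightarrow> real" where
  "change_prob \<Psi> \<kappa> r q init xs = \<Psi> (xi \<kappa> r q init xs (int (length xs)))"

text \<open>Matrix and vector indices start at \<open>0\<close>, whereas the coefficients \<open>r\<close> are indexed from \<open>1\<close>.\<close>

definition companion :: "nat \<Rightarrow> (nat \<Rightarrow> real) \<Rightarrow> real mat" where
  "companion \<kappa> r =
     mat \<kappa> \<kappa> (\<lambda>(i, j). if i = 0 then r (j + 1) else if i = j + 1 then 1 else 0)"

definition input_vec :: "nat \<Rightarrow> (nat \<Rightarrow> real) \<Rightarrow> nat \<Rightarrow> real vec" where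
  "input_vec \<kappa> q x = vec \<kappa> (\<lambda>i. if i = 0 then q x else 0)"

text \<open>Cyclic extension of a nonempty block to integer positions, and the segment \<open>\<Xi>(i:j)\<close>.\<close>

definition cyc :: "nat list \<Rightarrow> int \<Rightarrow> nat" where
  "cyc \<Xi> i = \<Xi> ! nat ((i - 1) mod int (length \<Xi>))"

definition segment :: "nat list \<Rightarrow> int \<Rightarrow> int \<Rightarrow> nat list" where
  "segment \<Xi> i j = map (cyc \<Xi>) [i..j]"

text \<open>\<open>mat_inverse\<close> is partial; \<open>the\<close> is meaningful here because \<open>I - G\<^sup>\<ell>\<close> is invertible when the
  spectral radius of \<open>G\<close> is less than \<open>1\<close>.\<close>

definition chi :: "nat \<Rightarrow> (nat \<Rightarrow> real) \<Rightarrow> (nat \<Rightarrow> real) \<Rightarrow> nat list \<Rightarrow> int \<Rightarrow> real vec" where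
  "chi \<kappa> r q \<Xi> j =
     the (mat_inverse (1\<^sub>m \<kappa> - companion \<kappa> r ^\<^sub>m length \<Xi>)) *\<^sub>v
       finsum_vec TYPE(real) \<kappa>
         (\<lambda>i. (companion \<kappa> r ^\<^sub>m nat (j - i)) *\<^sub>v input_vec \<kappa> q (cyc \<Xi> i))
         {j - int (length \<Xi>) + 1..j}"

definition omega :: "real \<Rightarrow> real" where
  "omega x = \<bar>ln (1 - x)\<bar>"

definition block_rate ::
  "(real \<Rightarrow> real) \<Rightarrow> nat \<Rightarrow> (nat \<Rightarrow> real) \<Rightarrow> (nat \<Rightarrow> real) \<Rightarrow> nat list \<Rightarrow> real" where
  "block_rate \<Psi> \<kappa> r q \<Xi> =
     (1 / real (length \<Xi>)) * (\<Sum>j = 1..int (length \<Xi>). omega (\<Psi> (chi \<kappa> r q \<Xi> j $ 0)))"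

end

theory Submission
  imports Defs "HOL-Analysis.Elementary_Metric_Spaces"
begin

text \<open>Since the coefficients are nonnegative, \<open>\<rho>(G) < 1\<close> forces \<open>R = \<Sum>i. r i < 1\<close>, so the scalar
  recursion is itself a contraction: a bounded solution of the homogeneous recursion shrinks by
  the factor \<open>R\<close> every \<open>\<kappa>\<close> steps. The first coordinates \<open>\<eta> j\<close> of the vectors \<open>\<chi> j\<close> form an
  \<open>\<ell>\<close>-periodic solution of the recursion driven by the block. All trajectories of \<open>\<xi>\<close> stay in one
  compact interval, whatever the first treatments are, so \<open>\<xi>\<close> approaches \<open>\<eta>\<close> uniformly and
  \<open>\<omega> \<circ> \<Psi>\<close> is uniformly continuous where it matters. What remains is the average of a periodic
  function, which differs from its mean over one period by \<open>O(1 / M)\<close>.\<close>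

subsection \<open>Companion matrices\<close>

lemma companion_carrier [simp]: "companion \<kappa> r \<in> carrier_mat \<kappa> \<kappa>"
  by (simp add: companion_def)

lemma dim_companion [simp]: "dim_row (companion \<kappa> r) = \<kappa>" "dim_col (companion \<kappa> r) = \<kappa>"
  by (simp_all add: companion_def)

lemma companion_mult_vec_0:
  assumes "v \<in> carrier_vec \<kappa>" "\<kappa> \<ge> 1"
  shows "(companion \<kappa> r *\<^sub>v v) $ 0 = (\<Sum>i = 1..\<kappa>. r i * v $ (i - 1))"
proof -
  have "(companion \<kappa> r *\<^sub>v v) $ 0 = (\<Sum>i = 0..<\<kappa>. r (Suc i) * v $ i)"
    using assms by (auto simp: companion_def scalar_prod_def intro!: sum.cong)
  also have "\<dots> = (\<Sum>i = Suc 0..<Suc \<kappa>. r i * v $ (i - 1))"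
    by (simp only: sum.shift_bounds_Suc_ivl diff_Suc_1)
  finally show ?thesis
    by (simp add: atLeastLessThanSuc_atLeastAtMost)
qed

lemma companion_mult_vec_Suc:
  assumes "v \<in> carrier_vec \<kappa>" "Suc i < \<kappa>"
  shows "(companion \<kappa> r *\<^sub>v v) $ Suc i = v $ i"
proof -
  have "(companion \<kappa> r *\<^sub>v v) $ Suc i = (\<Sum>j = 0..<\<kappa>. (if i = j then 1 else 0) * v $ j)"
    using assms by (auto simp: companion_def scalar_prod_def intro!: sum.cong)
  also have "\<dots> = (\<Sum>j = 0..<\<kappa>. if i = j then v $ j else 0)"
    by (intro sum.cong) auto
  finally show ?thesis
    using assms by simp
qed

text \<open>If the coefficients summed to at least 1, the intermediate value theorem would give
  \<open>y \<in> (0, 1]\<close> with \<open>\<Sum>i. r i * y ^ i = 1\<close>; then \<open>(1, y, y\<^sup>2, \<dots>)\<close> is an eigenvector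
  for the eigenvalue \<open>1 / y \<ge> 1\<close>.\<close>

lemma sum_coeffs_less_1:
  assumes "\<kappa> \<ge> 1" and sr: "spectral_radius (map_mat complex_of_real (companion \<kappa> r)) < 1"
  shows "(\<Sum>i = 1..\<kappa>. r i) < 1"
proof (rule ccontr)
  assume *: "\<not> ?thesis"
  let ?g = "\<lambda>y. \<Sum>i = 1..\<kappa>. r i * y ^ i"
  have "?g 0 = 0"
    by (intro sum.neutral) auto
  then have "\<exists>y\<ge>0. y \<le> 1 \<and> ?g y = 1"
    using * by (intro IVT') (auto intro!: continuous_intros)
  then obtain y where y: "0 \<le> y" "y \<le> 1" "?g y = 1"
    by blast
  have "y \<noteq> 0"
    using y(3) \<open>?g 0 = 0\<close> by auto
  with y have "y > 0"
    by simp
  define v where "v = vec \<kappa> (\<lambda>i. y ^ i)"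
  have v: "v \<in> carrier_vec \<kappa>"
    by (simp add: v_def)
  have "eigenvector (companion \<kappa> r) v (1 / y)"
    unfolding eigenvector_def
  proof (intro conjI)
    show "v \<in> carrier_vec (dim_row (companion \<kappa> r))"
      by (simp add: v_def companion_def)
    have "v $ 0 \<noteq> 0\<^sub>v \<kappa> $ 0"
      using assms(1) by (simp add: v_def)
    then show "v \<noteq> 0\<^sub>v (dim_row (companion \<kappa> r))"
      by (auto simp: companion_def)
    show "companion \<kappa> r *\<^sub>v v = (1 / y) \<cdot>\<^sub>v v"
    proof (rule eq_vecI)
      fix i assume "i < dim_vec ((1 / y) \<cdot>\<^sub>v v)"
      then have i: "i < \<kappa>"
        by (simp add: v_def)
      show "(companion \<kappa> r *\<^sub>v v) $ i = ((1 / y) \<cdot>\<^sub>v v) $ i"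
      proof (cases i)
        case 0
        have "(companion \<kappa> r *\<^sub>v v) $ 0 = (\<Sum>i = 1..\<kappa>. r i * v $ (i - 1))"
          by (rule companion_mult_vec_0[OF v assms(1)])
        also have "\<dots> = (\<Sum>i = 1..\<kappa>. (1 / y) * (r i * y ^ i))"
        proof (rule sum.cong)
          fix i assume i: "i \<in> {1..\<kappa>}"
          then have "y ^ i = y * y ^ (i - 1)"
            by (cases i) auto
          moreover have "i - 1 < \<kappa>"
            using i by auto
          ultimately show "r i * v $ (i - 1) = (1 / y) * (r i * y ^ i)"
            using \<open>y > 0\<close> by (simp add: v_def)
        qed simp
        also have "\<dots> = 1 / y"
          using y(3) by (simp flip: sum_distrib_left sum_divide_distrib)
        finally show ?thesis
          using 0 i by (simp add: v_def)
      next
        case (Suc k)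
        then show ?thesis
          using i \<open>y > 0\<close> companion_mult_vec_Suc[OF v, of k r] by (simp add: v_def)
      qed
    qed (simp add: companion_def v_def)
  qed
  then have "eigenvector (map_mat complex_of_real (companion \<kappa> r))
      (map_vec complex_of_real v) (complex_of_real (1 / y))"
    by (rule of_real_hom.eigenvector_hom[OF companion_carrier])
  then have "norm (complex_of_real (1 / y)) \<in> norm ` spectrum (map_mat complex_of_real (companion \<kappa> r))"
    by (intro imageI) (auto simp: spectrum_def eigenvalue_def)
  then have "norm (complex_of_real (1 / y)) \<le> spectral_radius (map_mat complex_of_real (companion \<kappa> r))"
    using assms(1) by (intro spectral_radius_mem_max(2)[where n = \<kappa>]) auto
  moreover have "norm (complex_of_real (1 / y)) \<ge> 1"
    using y \<open>y > 0\<close> unfolding norm_of_real by simp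
  ultimately show False
    using sr by linarith
qed

lemma pow_mat_commute:
  fixes A :: "'a :: semiring_1 mat"
  assumes "A \<in> carrier_mat n n"
  shows "A * A ^\<^sub>m k = A ^\<^sub>m k * A"
proof (induction k)
  case 0
  then show ?case using assms by simp
next
  case (Suc k)
  have "A * A ^\<^sub>m Suc k = (A * A ^\<^sub>m k) * A"
    using assms by (simp add: assoc_mult_mat[of _ n n _ n _ n])
  then show ?case
    by (simp add: Suc)
qed

text \<open>Along a periodic orbit \<open>v, G v, G\<^sup>2 v, \<dots>\<close> the first coordinates satisfy the homogeneous
  recursion, so their maximum modulus \<open>A\<close> satisfies \<open>A \<le> (\<Sum>i. r i) * A\<close>.\<close>

lemma companion_pow_fixed_imp_zero:
  fixes r :: "nat \<Rightarrow> real"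
  assumes "\<kappa> \<ge> 1" "l \<ge> 1" and r: "\<And>i. i \<in> {1..\<kappa>} \<Longrightarrow> r i \<ge> 0" "(\<Sum>i = 1..\<kappa>. r i) < 1"
    and v: "v \<in> carrier_vec \<kappa>" and fixed: "companion \<kappa> r ^\<^sub>m l *\<^sub>v v = v"
  shows "v = 0\<^sub>v \<kappa>"
proof -
  let ?G = "companion \<kappa> r"
  define w where "w m = ?G ^\<^sub>m m *\<^sub>v v" for m
  have w: "w m \<in> carrier_vec \<kappa>" for m
    using v unfolding w_def by (intro mult_mat_vec_carrier[of _ _ \<kappa>]) auto
  have w_Suc: "w (Suc m) = ?G *\<^sub>v w m" for m
    using v pow_mat_commute[of ?G \<kappa> m]
    by (simp add: w_def assoc_mult_mat_vec[of _ \<kappa> \<kappa> _ \<kappa>, symmetric])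
  have w_add_l: "w (m + l) = w m" for m
  proof (induction m)
    case 0
    then show ?case
      using v fixed by (simp add: w_def one_mult_mat_vec[of _ \<kappa>] companion_def)
  qed (simp add: w_Suc)
  have periodic: "w (m + k * l) = w m" for m k
  proof (induction k)
    case (Suc k)
    then show ?case
      using w_add_l[of "m + k * l"] by (simp add: ac_simps)
  qed simp
  define a where "a m = w m $ 0" for m
  have shift: "i < \<kappa> \<Longrightarrow> i \<le> m \<Longrightarrow> w m $ i = a (m - i)" for i m
  proof (induction i arbitrary: m)
    case 0
    then show ?case by (simp add: a_def)
  next
    case (Suc i)
    then obtain m' where "m = Suc m'"
      by (cases m) auto
    with Suc show ?case
      using companion_mult_vec_Suc[OF w[of m'], of i r] by (simp add: w_Suc)
  qed
  define A where "A = Max ((\<lambda>m. \<bar>a m\<bar>) ` {..<l})"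
  have a_le: "\<bar>a m\<bar> \<le> A" for m
  proof -
    have "a m = a (m mod l)"
      using periodic[of "m mod l" "m div l"] by (simp add: a_def)
    then show ?thesis
      unfolding A_def using assms(2) by (auto intro!: Max_ge)
  qed
  have "A \<in> (\<lambda>m. \<bar>a m\<bar>) ` {..<l}"
    unfolding A_def using assms(2) by (intro Max_in) (auto simp: lessThan_empty_iff bot_nat_def)
  then obtain p where p: "A = \<bar>a p\<bar>"
    by auto
  have "A \<ge> 0"
    by (simp add: p)
  have "p + \<kappa> * l \<ge> \<kappa>"
    using assms(2) by (cases l) auto
  then obtain m where m: "p + \<kappa> * l = Suc m" "\<kappa> \<le> Suc m"
    using assms(1) by (cases "p + \<kappa> * l") auto
  have "a p = w (Suc m) $ 0"
    using periodic[of p \<kappa>] m by (simp add: a_def)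
  also have "\<dots> = (\<Sum>i = 1..\<kappa>. r i * w m $ (i - 1))"
    using companion_mult_vec_0[OF w assms(1)] by (simp add: w_Suc)
  also have "\<dots> = (\<Sum>i = 1..\<kappa>. r i * a (m - (i - 1)))"
    using m by (intro sum.cong) (auto simp: shift)
  finally have "A \<le> (\<Sum>i = 1..\<kappa>. \<bar>r i * a (m - (i - 1))\<bar>)"
    by (simp add: p sum_abs)
  also have "\<dots> \<le> (\<Sum>i = 1..\<kappa>. r i * A)"
    using r a_le by (intro sum_mono) (auto simp: abs_mult intro!: mult_left_mono)
  also have "\<dots> = (\<Sum>i = 1..\<kappa>. r i) * A"
    by (rule sum_distrib_right[symmetric])
  finally have "A = 0"
    using r(2) \<open>A \<ge> 0\<close> by (metis mult_le_cancel_right1 not_le order_antisym)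
  then have a0: "a m = 0" for m
    using a_le[of m] by simp
  show ?thesis
  proof (rule eq_vecI)
    fix i assume "i < dim_vec (0\<^sub>v \<kappa> :: real vec)"
    then have i: "i < \<kappa>"
      by simp
    have "\<kappa> \<le> \<kappa> * l"
      using assms(2) by (cases l) auto
    with i have "i \<le> \<kappa> * l"
      by linarith
    then have "w (\<kappa> * l) $ i = 0"
      using shift[OF i, of "\<kappa> * l"] i a0 by simp
    moreover have "w (\<kappa> * l) = v"
      using periodic[of 0 \<kappa>] v by (simp add: w_def)
    ultimately show "v $ i = 0\<^sub>v \<kappa> $ i"
      using i by simp
  qed (use v in auto)
qed

lemma mat_inverse_of_injective:
  fixes A :: "'a :: field mat"
  assumes A: "A \<in> carrier_mat n n"
    and inj: "\<And>v. v \<in> carrier_vec n \<Longrightarrow> A *\<^sub>v v = 0\<^sub>v n \<Longrightarrow> v = 0\<^sub>v n"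
  shows "the (mat_inverse A) \<in> carrier_mat n n" "A * the (mat_inverse A) = 1\<^sub>m n"
    "the (mat_inverse A) * A = 1\<^sub>m n"
proof -
  have "det A \<noteq> 0"
    using inj det_0_iff_vec_prod_zero_field[OF A] by blast
  then have "A \<in> Units (ring_mat TYPE('a) n ())"
    by (rule det_non_zero_imp_unit[OF A])
  then have "mat_inverse A \<noteq> None"
    using mat_inverse(1)[OF A, of "()"] by blast
  then obtain B where "mat_inverse A = Some B"
    by blast
  then show "the (mat_inverse A) \<in> carrier_mat n n" "A * the (mat_inverse A) = 1\<^sub>m n"
    "the (mat_inverse A) * A = 1\<^sub>m n"
    using mat_inverse(2)[OF A] by auto
qed

subsection \<open>The periodic solution\<close>

definition conv_sum :: "nat \<Rightarrow> 'a :: comm_ring_1 mat \<Rightarrow> (int \<Rightarrow> 'a vec) \<Rightarrow> nat \<Rightarrow> int \<Rightarrow> 'a vec" where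
  "conv_sum n A u m j =
     finsum_vec TYPE('a) n (\<lambda>i. A ^\<^sub>m nat (j - i) *\<^sub>v u i) {j - int m + 1..j}"

context
  fixes A :: "'a :: comm_ring_1 mat" and n :: nat and u :: "int \<Rightarrow> 'a vec"
  assumes A: "A \<in> carrier_mat n n" and u: "\<And>i. u i \<in> carrier_vec n"
begin

lemma pow_mult_vec_carrier: "A ^\<^sub>m k *\<^sub>v u i \<in> carrier_vec n"
  using A u by (intro mult_mat_vec_carrier[of _ _ n]) auto

lemma conv_sum_carrier: "conv_sum n A u m j \<in> carrier_vec n"
  unfolding conv_sum_def by (intro finsum_vec_closed) (use pow_mult_vec_carrier in auto)

lemma conv_sum_0: "conv_sum n A u 0 j = 0\<^sub>v n"
  by (simp add: conv_sum_def finsum_vec_empty)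

lemma conv_sum_Suc: "conv_sum n A u (Suc m) j = A ^\<^sub>m m *\<^sub>v u (j - int m) + conv_sum n A u m j"
proof -
  have "{j - int (Suc m) + 1..j} = insert (j - int m) {j - int m + 1..j}"
    by auto
  then show ?thesis
    unfolding conv_sum_def
    by (simp only: , subst finsum_vec_insert) (use pow_mult_vec_carrier in auto)
qed

lemma conv_sum_step: "conv_sum n A u (Suc m) (j + 1) = A *\<^sub>v conv_sum n A u m j + u (j + 1)"
proof (induction m)
  case 0
  have "A *\<^sub>v 0\<^sub>v n = 0\<^sub>v n"
    using A by (intro eq_vecI) auto
  then show ?case
    using A u by (simp add: conv_sum_Suc conv_sum_0 mult_mat_vec_carrier[of A n n])
next
  case (Suc m)
  have "conv_sum n A u (Suc (Suc m)) (j + 1) =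
      A ^\<^sub>m Suc m *\<^sub>v u (j - int m) + (A *\<^sub>v conv_sum n A u m j + u (j + 1))"
    by (subst conv_sum_Suc) (simp only: Suc, simp)
  also have "A ^\<^sub>m Suc m *\<^sub>v u (j - int m) = A *\<^sub>v (A ^\<^sub>m m *\<^sub>v u (j - int m))"
    using A u pow_mat_commute[OF A, of m] by (simp flip: assoc_mult_mat_vec[of _ n n _ n])
  also have "\<dots> + (A *\<^sub>v conv_sum n A u m j + u (j + 1)) =
      A *\<^sub>v conv_sum n A u (Suc m) j + u (j + 1)"
    using A u pow_mult_vec_carrier conv_sum_carrier
    by (simp add: conv_sum_Suc mult_add_distrib_mat_vec[of _ n n]
        assoc_add_vec[of _ n] mult_mat_vec_carrier[of A n n])
  finally show ?case .
qed

lemma conv_sum_periodic: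
  assumes "\<And>i. u (i + p) = u i"
  shows "conv_sum n A u m (j + p) = conv_sum n A u m j"
proof (induction m)
  case (Suc m)
  have "u (j + p - int m) = u (j - int m)"
    using assms[of "j - int m"] by (simp add: algebra_simps)
  then show ?case
    by (simp only: conv_sum_Suc Suc)
qed (simp add: conv_sum_0)

end

lemma cyc_in_set: "\<Xi> \<noteq> [] \<Longrightarrow> cyc \<Xi> i \<in> set \<Xi>"
  unfolding cyc_def by (intro nth_mem) (simp add: nat_less_iff)

lemma cyc_periodic: "cyc \<Xi> (i + int (length \<Xi>)) = cyc \<Xi> i"
proof -
  have "i + int (length \<Xi>) - 1 = (i - 1) + int (length \<Xi>)"
    by simp
  then show ?thesis
    unfolding cyc_def by (simp only: mod_add_self2)
qed

lemma segment_nth: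
  assumes "n < s"
  shows "segment \<Xi> j (int s + j - 1) ! n = cyc \<Xi> (j + int n)"
  using assms by (simp add: segment_def nth_upto)

lemma length_segment: "length (segment \<Xi> j (int s + j - 1)) = s"
  by (simp add: segment_def)

context
  fixes \<kappa> :: nat and r q :: "nat \<Rightarrow> real" and \<Xi> :: "nat list"
  assumes kappa: "\<kappa> \<ge> 1" and r_nonneg: "\<And>i. i \<in> {1..\<kappa>} \<Longrightarrow> r i \<ge> 0"
    and r_sum: "(\<Sum>i = 1..\<kappa>. r i) < 1" and block: "\<Xi> \<noteq> []"
begin

text \<open>With \<open>T j\<close> the sum in the definition of \<open>\<chi> j\<close>, periodicity of the input telescopes to
  \<open>T (j + 1) = G T j + (I - G\<^sup>\<ell>) Q\<close> with \<open>Q\<close> the input at \<open>j + 1\<close>, and \<open>(I - G\<^sup>\<ell>)\<close> commutes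
  with \<open>G\<close>.\<close>

lemma chi_rec:
  "chi \<kappa> r q \<Xi> j \<in> carrier_vec \<kappa>"
  "chi \<kappa> r q \<Xi> (j + int (length \<Xi>)) = chi \<kappa> r q \<Xi> j"
  "chi \<kappa> r q \<Xi> (j + 1) = companion \<kappa> r *\<^sub>v chi \<kappa> r q \<Xi> j + input_vec \<kappa> q (cyc \<Xi> (j + 1))"
proof -
  let ?G = "companion \<kappa> r" and ?l = "length \<Xi>"
  let ?C = "1\<^sub>m \<kappa> - ?G ^\<^sub>m ?l"
  define B where "B = the (mat_inverse ?C)"
  define u where "u i = input_vec \<kappa> q (cyc \<Xi> i)" for i
  define T where "T = conv_sum \<kappa> ?G u ?l"
  have u: "u i \<in> carrier_vec \<kappa>" for i
    by (simp add: u_def input_vec_def)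
  have u_per: "u (i + int ?l) = u i" for i
    by (simp add: u_def cyc_periodic)
  have G: "?G \<in> carrier_mat \<kappa> \<kappa>" and Gl: "?G ^\<^sub>m ?l \<in> carrier_mat \<kappa> \<kappa>"
    by auto
  have C: "?C \<in> carrier_mat \<kappa> \<kappa>"
    by (intro minus_carrier_mat Gl)
  have C_mult: "?C *\<^sub>v v = v - ?G ^\<^sub>m ?l *\<^sub>v v" if "v \<in> carrier_vec \<kappa>" for v
    using minus_mult_distrib_mat_vec[OF one_carrier_mat Gl that] that by simp
  have inj: "v = 0\<^sub>v \<kappa>" if v: "v \<in> carrier_vec \<kappa>" "?C *\<^sub>v v = 0\<^sub>v \<kappa>" for v
  proof (rule companion_pow_fixed_imp_zero[OF kappa _ r_nonneg r_sum v(1)])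
    show "1 \<le> ?l"
      using block by (cases \<Xi>) auto
    have Gv: "?G ^\<^sub>m ?l *\<^sub>v v \<in> carrier_vec \<kappa>"
      by (rule mult_mat_vec_carrier[OF Gl v(1)])
    have *: "v - ?G ^\<^sub>m ?l *\<^sub>v v = 0\<^sub>v \<kappa>"
      using v C_mult by simp
    show "?G ^\<^sub>m ?l *\<^sub>v v = v"
    proof (rule eq_vecI)
      fix i assume "i < dim_vec v"
      then show "(?G ^\<^sub>m ?l *\<^sub>v v) $ i = v $ i"
        using arg_cong[OF *, of "\<lambda>w. w $ i"] v(1) Gv by simp
    qed (use v(1) Gv in simp)
  qed
  note B = mat_inverse_of_injective[OF C inj, folded B_def]
  have chi: "chi \<kappa> r q \<Xi> j = B *\<^sub>v T j" for j
    by (simp add: chi_def B_def T_def conv_sum_def u_def)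
  have T: "T j \<in> carrier_vec \<kappa>" for j
    unfolding T_def by (rule conv_sum_carrier[OF G u])
  show chi_carrier: "chi \<kappa> r q \<Xi> j \<in> carrier_vec \<kappa>" for j
    unfolding chi by (rule mult_mat_vec_carrier[OF B(1) T])
  show "chi \<kappa> r q \<Xi> (j + int ?l) = chi \<kappa> r q \<Xi> j"
    unfolding chi T_def using conv_sum_periodic[of ?G \<kappa> u, OF G u u_per] by simp
  define w where "w = ?G *\<^sub>v chi \<kappa> r q \<Xi> j + u (j + 1)"
  have Gchi: "?G *\<^sub>v chi \<kappa> r q \<Xi> j \<in> carrier_vec \<kappa>"
    by (rule mult_mat_vec_carrier[OF G chi_carrier])
  have w: "w \<in> carrier_vec \<kappa>"
    unfolding w_def using Gchi u by simp
  have C_chi: "?C *\<^sub>v chi \<kappa> r q \<Xi> j = T j"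
    unfolding chi using T by (simp flip: assoc_mult_mat_vec[OF C B(1)] add: B(2))
  have CG: "?C * ?G = ?G * ?C"
    using pow_mat_commute[OF G, of ?l]
    by (simp add: minus_mult_distrib_mat[OF one_carrier_mat Gl G]
        mult_minus_distrib_mat[OF G one_carrier_mat Gl] left_mult_one_mat[OF G] right_mult_one_mat[OF G])
  have "?C *\<^sub>v w = ?C *\<^sub>v (?G *\<^sub>v chi \<kappa> r q \<Xi> j) + ?C *\<^sub>v u (j + 1)"
    unfolding w_def by (rule mult_add_distrib_mat_vec[OF C Gchi u])
  also have "?C *\<^sub>v (?G *\<^sub>v chi \<kappa> r q \<Xi> j) = ?G *\<^sub>v (?C *\<^sub>v chi \<kappa> r q \<Xi> j)"
    using CG by (simp flip: assoc_mult_mat_vec[OF C G chi_carrier] assoc_mult_mat_vec[OF G C chi_carrier])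
  also have "\<dots> = ?G *\<^sub>v T j"
    by (simp only: C_chi)
  also have "?C *\<^sub>v u (j + 1) = u (j + 1) - ?G ^\<^sub>m ?l *\<^sub>v u (j + 1)"
    by (rule C_mult[OF u])
  finally have Cw: "?C *\<^sub>v w = ?G *\<^sub>v T j + (u (j + 1) - ?G ^\<^sub>m ?l *\<^sub>v u (j + 1))" .
  have "u (j + 1 - int ?l) = u (j + 1)"
    using u_per[of "j + 1 - int ?l"] by simp
  then have *: "?G ^\<^sub>m ?l *\<^sub>v u (j + 1) + T (j + 1) = ?G *\<^sub>v T j + u (j + 1)"
    using conv_sum_Suc[of ?G \<kappa> u ?l "j + 1", OF G u] conv_sum_step[of ?G \<kappa> u ?l j, OF G u] by (simp add: T_def)
  have step: "(?G ^\<^sub>m ?l *\<^sub>v u (j + 1)) $ i + T (j + 1) $ i = (?G *\<^sub>v T j) $ i + u (j + 1) $ i"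
    if "i < \<kappa>" for i
    using arg_cong[OF *, of "\<lambda>v. v $ i"] that carrier_vecD[OF T[of "j + 1"]] carrier_vecD[OF u[of "j + 1"]]
    by (simp only: index_add_vec)
  have "?C *\<^sub>v w = T (j + 1)"
    unfolding Cw
  proof (rule eq_vecI)
    show "dim_vec (?G *\<^sub>v T j + (u (j + 1) - ?G ^\<^sub>m ?l *\<^sub>v u (j + 1))) = dim_vec (T (j + 1))"
      using T[of "j + 1"] Gl by (simp add: companion_def)
    fix i assume "i < dim_vec (T (j + 1))"
    then have "i < \<kappa>"
      using T[of "j + 1"] by simp
    then show "(?G *\<^sub>v T j + (u (j + 1) - ?G ^\<^sub>m ?l *\<^sub>v u (j + 1))) $ i = T (j + 1) $ i"
      using step[of i] Gl u[of "j + 1"] by simp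
  qed
  then have "B *\<^sub>v (?C *\<^sub>v w) = chi \<kappa> r q \<Xi> (j + 1)"
    by (simp add: chi)
  then show "chi \<kappa> r q \<Xi> (j + 1) = ?G *\<^sub>v chi \<kappa> r q \<Xi> j + input_vec \<kappa> q (cyc \<Xi> (j + 1))"
    using w by (simp flip: assoc_mult_mat_vec[OF B(1) C] add: B(3)) (simp add: w_def u_def)
qed

lemma chi_first_coordinate_rec:
  "chi \<kappa> r q \<Xi> j $ 0 = (\<Sum>i = 1..\<kappa>. r i * chi \<kappa> r q \<Xi> (j - int i) $ 0) + q (cyc \<Xi> j)"
proof -
  have shift: "i < \<kappa> \<Longrightarrow> chi \<kappa> r q \<Xi> j $ i = chi \<kappa> r q \<Xi> (j - int i) $ 0" for i j
  proof (induction i arbitrary: j)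
    case (Suc i)
    have "chi \<kappa> r q \<Xi> j $ Suc i = (companion \<kappa> r *\<^sub>v chi \<kappa> r q \<Xi> (j - 1)) $ Suc i"
      using chi_rec(3)[of "j - 1"] Suc.prems by (simp add: input_vec_def)
    also have "\<dots> = chi \<kappa> r q \<Xi> (j - 1) $ i"
      by (rule companion_mult_vec_Suc[OF chi_rec(1) Suc.prems])
    finally show ?case
      using Suc by (simp add: algebra_simps)
  qed simp
  have "chi \<kappa> r q \<Xi> j $ 0 = (companion \<kappa> r *\<^sub>v chi \<kappa> r q \<Xi> (j - 1)) $ 0 + q (cyc \<Xi> j)"
    using chi_rec(3)[of "j - 1"] kappa by (simp add: input_vec_def)
  also have "(companion \<kappa> r *\<^sub>v chi \<kappa> r q \<Xi> (j - 1)) $ 0 =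
      (\<Sum>i = 1..\<kappa>. r i * chi \<kappa> r q \<Xi> (j - 1) $ (i - 1))"
    by (rule companion_mult_vec_0[OF chi_rec(1) kappa])
  also have "\<dots> = (\<Sum>i = 1..\<kappa>. r i * chi \<kappa> r q \<Xi> (j - int i) $ 0)"
  proof (rule sum.cong)
    fix i assume i: "i \<in> {1..\<kappa>}"
    then have "j - 1 - int (i - 1) = j - int i"
      by simp
    then show "r i * chi \<kappa> r q \<Xi> (j - 1) $ (i - 1) = r i * chi \<kappa> r q \<Xi> (j - int i) $ 0"
      using shift[of "i - 1" "j - 1"] i by auto
  qed simp
  finally show ?thesis .
qed

end

lemma int_periodic_add_mult:
  fixes g :: "int \<Rightarrow> 'a"
  assumes "\<And>n. g (n + p) = g n"
  shows "g (n + k * p) = g n"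
proof (induction k rule: int_induct[of _ 0])
  case (step1 i)
  then show ?case
    using assms[of "n + i * p"] by (simp add: algebra_simps)
next
  case (step2 i)
  then show ?case
    using assms[of "n + (i - 1) * p"] by (simp add: algebra_simps)
qed simp

lemma int_periodic_mod:
  fixes g :: "int \<Rightarrow> 'a"
  assumes "\<And>n. g (n + p) = g n"
  shows "g (n mod p) = g n"
  using int_periodic_add_mult[of g p "n mod p" "n div p", OF assms] by simp

subsection \<open>Contraction and averaging\<close>

lemma linear_recursion_decay:
  fixes e :: "int \<Rightarrow> real"
  assumes r: "\<And>i. i \<in> {1..\<kappa>} \<Longrightarrow> r i \<ge> 0"
    and rec: "\<And>n. 1 \<le> n \<Longrightarrow> n \<le> N \<Longrightarrow> e n = (\<Sum>i = 1..\<kappa>. r i * e (n - int i))"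
    and bound: "\<And>n. - int \<kappa> < n \<Longrightarrow> n \<le> N \<Longrightarrow> \<bar>e n\<bar> \<le> B"
  shows "int \<kappa> * (int k - 1) < n \<Longrightarrow> n \<le> N \<Longrightarrow> \<bar>e n\<bar> \<le> (\<Sum>i = 1..\<kappa>. r i) ^ k * B"
proof (induction k arbitrary: n)
  case 0
  then show ?case
    using bound[of n] by simp
next
  case (Suc k)
  have "0 \<le> int \<kappa> * int k" "int \<kappa> * int k < n"
    using Suc.prems by simp_all
  then have "1 \<le> n"
    by linarith
  have "\<bar>r i * e (n - int i)\<bar> \<le> r i * ((\<Sum>i = 1..\<kappa>. r i) ^ k * B)" if i: "i \<in> {1..\<kappa>}" for i
  proof -
    have "int \<kappa> * (int k - 1) < n - int i" "n - int i \<le> N"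
      using Suc.prems i by (simp_all add: algebra_simps)
    from Suc.IH[OF this] show ?thesis
      using r[OF i] by (simp add: abs_mult mult_left_mono)
  qed
  then have "\<bar>e n\<bar> \<le> (\<Sum>i = 1..\<kappa>. r i * ((\<Sum>i = 1..\<kappa>. r i) ^ k * B))"
    unfolding rec[OF \<open>1 \<le> n\<close> Suc.prems(2)] by (intro order_trans[OF sum_abs] sum_mono)
  also have "\<dots> = (\<Sum>i = 1..\<kappa>. r i) ^ Suc k * B"
    by (simp flip: sum_distrib_right add: mult.assoc)
  finally show ?case .
qed

lemma xi_bounded:
  assumes r: "\<And>i. i \<in> {1..\<kappa>} \<Longrightarrow> r i \<ge> 0"
    and init: "\<And>t. - int \<kappa> < t \<Longrightarrow> t \<le> 0 \<Longrightarrow> \<bar>init t\<bar> \<le> B"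
    and q: "\<And>x. x \<in> set xs \<Longrightarrow> \<bar>q x\<bar> \<le> D"
    and B: "(\<Sum>i = 1..\<kappa>. r i) * B + D \<le> B"
  shows "- int \<kappa> < t \<Longrightarrow> t \<le> int (length xs) \<Longrightarrow> \<bar>xi \<kappa> r q init xs t\<bar> \<le> B"
proof (induction "nat t" arbitrary: t rule: less_induct)
  case less
  show ?case
  proof (cases "t \<le> 0")
    case True
    then show ?thesis
      using init less.prems by (subst xi.simps) simp
  next
    case False
    have "\<bar>r i * xi \<kappa> r q init xs (t - int i)\<bar> \<le> r i * B" if i: "i \<in> {1..\<kappa>}" for i
    proof -
      have "\<bar>xi \<kappa> r q init xs (t - int i)\<bar> \<le> B"
        by (rule less.hyps) (use False less.prems i in auto)
      then show ?thesis
        using r[OF i] by (simp add: abs_mult mult_left_mono)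
    qed
    then have "\<bar>\<Sum>i = 1..\<kappa>. r i * xi \<kappa> r q init xs (t - int i)\<bar> \<le> (\<Sum>i = 1..\<kappa>. r i * B)"
      by (intro order_trans[OF sum_abs] sum_mono)
    also have "\<dots> = (\<Sum>i = 1..\<kappa>. r i) * B"
      by (simp flip: sum_distrib_right)
    finally have "\<bar>\<Sum>i = 1..\<kappa>. r i * xi \<kappa> r q init xs (t - int i)\<bar> \<le> (\<Sum>i = 1..\<kappa>. r i) * B" .
    moreover have "\<bar>q (xs ! (nat t - 1))\<bar> \<le> D"
      using False less.prems by (intro q nth_mem) auto
    ultimately show ?thesis
      using False B by (subst xi.simps) simp
  qed
qed

lemma periodic_window_sum:
  fixes g :: "int \<Rightarrow> 'a :: ab_group_add"
  assumes "\<And>n. g (n + int l) = g n"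
  shows "(\<Sum>s<l. g (c + int s)) = (\<Sum>s<l. g (int s))"
proof -
  have step: "(\<Sum>s<l. g (c + 1 + int s)) = (\<Sum>s<l. g (c + int s))" for c
  proof -
    have "g c + (\<Sum>s<l. g (c + 1 + int s)) = (\<Sum>s<Suc l. g (c + int s))"
      by (subst sum.lessThan_Suc_shift) (simp add: ac_simps)
    also have "\<dots> = (\<Sum>s<l. g (c + int s)) + g c"
      using assms[of c] by simp
    finally show ?thesis
      by (simp add: add.commute)
  qed
  show ?thesis
  proof (induction c rule: int_induct[of _ 0])
    case (step1 i)
    then show ?case
      using step[of i] by simp
  next
    case (step2 i)
    then show ?case
      using step[of "i - 1"] by simp
  qed simp
qed

lemma periodic_zero_mean_sum_bound:
  fixes g :: "int \<Rightarrow> real"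
  assumes per: "\<And>n. g (n + int l) = g n" and "l \<ge> 1" and zero: "(\<Sum>s<l. g (int s)) = 0"
    and bound: "\<And>n. \<bar>g n\<bar> \<le> C"
  shows "\<bar>\<Sum>s<M. g (c + int s)\<bar> \<le> real l * C"
proof (induction M arbitrary: c rule: less_induct)
  case (less M)
  show ?case
  proof (cases "M < l")
    case True
    have "C \<ge> 0"
      using bound[of 0] by simp
    have "\<bar>\<Sum>s<M. g (c + int s)\<bar> \<le> (\<Sum>s<M. C)"
      by (intro order_trans[OF sum_abs] sum_mono bound)
    also have "\<dots> \<le> real l * C"
      using True \<open>C \<ge> 0\<close> by (simp add: mult_right_mono)
    finally show ?thesis .
  next
    case False
    then have M: "M = l + (M - l)" "M - l < M"
      using \<open>l \<ge> 1\<close> by auto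
    have "(\<Sum>s<l + k. g (c + int s)) = (\<Sum>s<l. g (c + int s)) + (\<Sum>s<k. g (c + int l + int s))" for k
      by (induction k) (simp_all add: ac_simps)
    then have "(\<Sum>s<l + (M - l). g (c + int s)) =
        (\<Sum>s<l. g (c + int s)) + (\<Sum>s<M - l. g (c + int l + int s))" .
    also have "(\<Sum>s<l. g (c + int s)) = 0"
      using periodic_window_sum[of g l c, OF per] zero by simp
    finally show ?thesis
      using less.IH[OF M(2), of "c + int l"] M(1) by simp
  qed
qed

lemma average_near_periodic:
  fixes a :: "nat \<Rightarrow> real" and b :: "int \<Rightarrow> real"
  assumes per: "\<And>n. b (n + int l) = b n" and l: "l \<ge> 1"
    and a: "\<And>s. s < M \<Longrightarrow> \<bar>a s\<bar> \<le> F" and b: "\<And>n. \<bar>b n\<bar> \<le> F"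
    and near: "\<And>s. N \<le> s \<Longrightarrow> s < M \<Longrightarrow> \<bar>a s - b (c + int s)\<bar> \<le> \<delta>" and "\<delta> \<ge> 0"
    and d: "d = (1 / real l) * (\<Sum>s<l. b (int s))"
  shows "\<bar>(\<Sum>s<M. a s) - real M * d\<bar> \<le> real M * \<delta> + 2 * F * (real N + real l)"
proof -
  have "F \<ge> 0"
    using b[of 0] by simp
  have "\<bar>\<Sum>s<l. b (int s)\<bar> \<le> (\<Sum>s<l. F)"
    by (intro order_trans[OF sum_abs] sum_mono b)
  then have "\<bar>d\<bar> \<le> F"
    using l by (simp add: d abs_mult field_simps)
  have "\<bar>\<Sum>s<M. b (c + int s) - d\<bar> \<le> real l * (2 * F)"
  proof (rule periodic_zero_mean_sum_bound[OF _ l])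
    show "(\<Sum>s<l. b (int s) - d) = 0"
      using l by (simp add: sum_subtractf d)
    show "\<bar>b n - d\<bar> \<le> 2 * F" for n
      using b[of n] \<open>\<bar>d\<bar> \<le> F\<close> by linarith
  qed (simp add: per)
  moreover have "\<bar>\<Sum>s<M. a s - b (c + int s)\<bar> \<le> real M * \<delta> + real N * (2 * F)"
  proof -
    have "\<bar>a s - b (c + int s)\<bar> \<le> \<delta> + (if s < N then 2 * F else 0)" if "s < M" for s
      using near[of s] a[OF that] b[of "c + int s"] \<open>\<delta> \<ge> 0\<close> that by auto
    then have "\<bar>\<Sum>s<M. a s - b (c + int s)\<bar> \<le> (\<Sum>s<M. \<delta> + (if s < N then 2 * F else 0))"
      by (intro order_trans[OF sum_abs] sum_mono) auto
    also have "\<dots> = real M * \<delta> + (\<Sum>s<M. if s < N then 2 * F else 0)"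
      by (simp add: sum.distrib)
    also have "(\<Sum>s<M. if s < N then 2 * F else 0) = real (min M N) * (2 * F)"
      by (induction M) (auto simp: min_def algebra_simps)
    also have "\<dots> \<le> real N * (2 * F)"
      using \<open>F \<ge> 0\<close> by (intro mult_right_mono) auto
    finally show ?thesis
      by simp
  qed
  moreover have "(\<Sum>s<M. a s) - real M * d =
      (\<Sum>s<M. a s - b (c + int s)) + (\<Sum>s<M. b (c + int s) - d)"
    by (simp add: sum_subtractf)
  ultimately show ?thesis
    by (simp add: algebra_simps)
qed

theorem lemmaF1:
  fixes K \<kappa> l :: nat
    and r q :: "nat \<Rightarrow> real"
    and init :: "int \<Rightarrow> real"
    and \<Psi> :: "real \<Rightarrow> real"
    and \<Xi> :: "nat list"
    and \<epsilon> :: real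
  assumes "K \<ge> 2"
    and "\<kappa> \<ge> 1"
    and "\<And>i. i \<in> {1..\<kappa>} \<Longrightarrow> r i \<in> {0..1}"
    and "\<And>x. x \<in> {1..K} \<Longrightarrow> q x \<ge> 0"
    and "\<And>u. \<Psi> u \<in> {0..<1}"
    and "continuous_on UNIV \<Psi>"
    and "spectral_radius (map_mat complex_of_real (companion \<kappa> r)) < 1"
    and "l \<ge> 1"
    and "\<Xi> \<in> treatments K l"
    and "\<epsilon> > 0"
  shows "\<exists>M0::nat. M0 > 0 \<and> (\<forall>M::nat. M \<ge> M0 \<longrightarrow>
    (SUP t::nat. SUP z\<in>treatments K t. SUP j\<in>{1..int l}.
       ereal \<bar>(1 / real M) *
                (\<Sum>s = 1..M. omega (change_prob \<Psi> \<kappa> r q init (z @ segment \<Xi> j (int s + j - 1))))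
              - block_rate \<Psi> \<kappa> r q \<Xi>\<bar>) \<le> ereal \<epsilon>)"
proof -
  define R where "R = (\<Sum>i = 1..\<kappa>. r i)"
  have r: "r i \<ge> 0" if "i \<in> {1..\<kappa>}" for i
    using assms(3)[OF that] by simp
  have R: "0 \<le> R" "R < 1"
    unfolding R_def using r sum_coeffs_less_1[OF assms(2,7)] by (auto intro: sum_nonneg)
  have \<Xi>: "length \<Xi> = l" "set \<Xi> \<subseteq> {1..K}"
    using assms(9) by (auto simp: treatments_def)
  with assms(8) have "\<Xi> \<noteq> []"
    by auto
  define \<eta> where "\<eta> n = chi \<kappa> r q \<Xi> n $ 0" for n
  have \<eta>_rec: "\<eta> n = (\<Sum>i = 1..\<kappa>. r i * \<eta> (n - int i)) + q (cyc \<Xi> n)" for n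
    unfolding \<eta>_def
    by (rule chi_first_coordinate_rec[OF assms(2) r sum_coeffs_less_1[OF assms(2,7)] \<open>\<Xi> \<noteq> []\<close>])
  have \<eta>_per: "\<eta> (n + int l) = \<eta> n" for n
    unfolding \<eta>_def
    using chi_rec(2)[OF assms(2) r sum_coeffs_less_1[OF assms(2,7)] \<open>\<Xi> \<noteq> []\<close>, of q n] \<Xi>(1) by simp

  define D where "D = (\<Sum>x\<in>{1..K}. \<bar>q x\<bar>)"
  define B where "B = (\<Sum>i<\<kappa>. \<bar>init (- int i)\<bar>) + D / (1 - R) + (\<Sum>n\<in>{0..<int l}. \<bar>\<eta> n\<bar>)"
  have nonneg: "D \<ge> 0" "D / (1 - R) \<ge> 0" "(\<Sum>i<\<kappa>. \<bar>init (- int i)\<bar>) \<ge> 0"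
    "(\<Sum>n\<in>{0..<int l}. \<bar>\<eta> n\<bar>) \<ge> 0"
    using R by (simp_all add: D_def sum_nonneg)
  have "B \<ge> 0"
    unfolding B_def using nonneg by linarith
  have q_le: "\<bar>q x\<bar> \<le> D" if "x \<in> {1..K}" for x
    unfolding D_def by (rule member_le_sum[OF that]) auto
  have init_le: "\<bar>init t\<bar> \<le> B" if "- int \<kappa> < t" "t \<le> 0" for t
  proof -
    have "\<bar>init (- int (nat (- t)))\<bar> \<le> (\<Sum>i<\<kappa>. \<bar>init (- int i)\<bar>)"
      by (rule member_le_sum) (use that in auto)
    then have "\<bar>init t\<bar> \<le> (\<Sum>i<\<kappa>. \<bar>init (- int i)\<bar>)"
      using that by simp
    then show ?thesis
      unfolding B_def using nonneg by linarith
  qed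
  have \<eta>_le: "\<bar>\<eta> n\<bar> \<le> B" for n
  proof -
    have "\<bar>\<eta> (n mod int l)\<bar> \<le> (\<Sum>n\<in>{0..<int l}. \<bar>\<eta> n\<bar>)"
      by (rule member_le_sum) (use assms(8) in auto)
    then show ?thesis
      unfolding B_def int_periodic_mod[of \<eta> "int l" n, OF \<eta>_per] using nonneg by linarith
  qed
  have "D / (1 - R) \<le> B"
    unfolding B_def using nonneg by linarith
  then have B_inv: "R * B + D \<le> B"
    using R by (simp add: field_simps)

  define f where "f u = omega (\<Psi> u)" for u
  have "continuous_on UNIV f"
    unfolding f_def omega_def
    using assms(5) by (intro continuous_intros assms(6)) (simp, metis less_irrefl)
  then have cont: "continuous_on {- B..B} f"
    by (rule continuous_on_subset) simp
  obtain \<delta> where "\<delta> > 0" and \<delta>: "\<And>u v. u \<in> {- B..B} \<Longrightarrow> v \<in> {- B..B} \<Longrightarrow> \<bar>u - v\<bar> < \<delta> \<Longrightarrow> \<bar>f u - f v\<bar> < \<epsilon> / 2"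
    using compact_uniformly_continuous[OF cont compact_Icc] assms(10)
    unfolding uniformly_continuous_on_def dist_real_def by (metis half_gt_zero)
  have "\<exists>F. \<forall>u\<in>{- B..B}. \<bar>f u\<bar> \<le> F"
    using compact_imp_bounded[OF compact_continuous_image[OF cont compact_Icc]]
    unfolding bounded_iff by simp
  then obtain F where F: "\<And>u. u \<in> {- B..B} \<Longrightarrow> \<bar>f u\<bar> \<le> F"
    by blast
  have "(\<lambda>k. R ^ k * (2 * B)) \<longlonglongrightarrow> 0 * (2 * B)"
    using R by (intro tendsto_mult LIMSEQ_power_zero tendsto_const) auto
  then have "\<forall>\<^sub>F k in sequentially. R ^ k * (2 * B) < \<delta>"
    using \<open>\<delta> > 0\<close> by (intro order_tendstoD(2)) auto
  then obtain k where k: "R ^ k * (2 * B) < \<delta>"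
    by (auto dest: eventually_happens)
  define N where "N = \<kappa> * k"
  obtain M1 :: nat where M1: "2 * (2 * F * (real N + real l)) / \<epsilon> \<le> real M1"
    using real_arch_simple by blast

  have main: "\<bar>(1 / real M) * (\<Sum>s = 1..M. omega (change_prob \<Psi> \<kappa> r q init (z @ segment \<Xi> j (int s + j - 1))))
              - block_rate \<Psi> \<kappa> r q \<Xi>\<bar> \<le> \<epsilon>"
    if M: "M \<ge> Suc M1" and z: "z \<in> treatments K t" for M t z and j :: int
  proof -
    define \<xi> where "\<xi> s = xi \<kappa> r q init (z @ segment \<Xi> j (int s + j - 1)) (int t + int s)" for s
    have \<xi>: "\<bar>\<xi> s\<bar> \<le> B" "N < s \<Longrightarrow> \<bar>\<xi> s - \<eta> (j - 1 + int s)\<bar> < \<delta>" for s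
    proof -
      define xs where "xs = z @ segment \<Xi> j (int s + j - 1)"
      have len: "length z = t" "length xs = t + s"
        using z by (simp_all add: xs_def length_segment treatments_def)
      have "set (segment \<Xi> j (int s + j - 1)) \<subseteq> {1..K}"
        using cyc_in_set[OF \<open>\<Xi> \<noteq> []\<close>] \<Xi>(2) by (auto simp: segment_def)
      then have "set xs \<subseteq> {1..K}"
        using z by (auto simp: xs_def treatments_def)
      then have bounded: "\<bar>xi \<kappa> r q init xs n\<bar> \<le> B" if "- int \<kappa> < n" "n \<le> int t + int s" for n
        using that len B_inv q_le init_le
        by (intro xi_bounded[where D = D] r) (auto simp: R_def)
      then show "\<bar>\<xi> s\<bar> \<le> B"
        using assms(2) by (simp add: \<xi>_def xs_def)
      define e where "e n = xi \<kappa> r q init xs (int t + n) - \<eta> (j - 1 + n)" for n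
      have "\<bar>e (int s)\<bar> \<le> R ^ k * (2 * B)" if "N < s"
        unfolding R_def
      proof (rule linear_recursion_decay[where N = "int s"])
        show "e n = (\<Sum>i = 1..\<kappa>. r i * e (n - int i))" if n: "1 \<le> n" "n \<le> int s" for n
        proof -
          have idx: "nat (int t + n) - 1 = length z + nat (n - 1)"
            using n len by linarith
          have "nat (n - 1) < s"
            using n by linarith
          then have "xs ! (nat (int t + n) - 1) = cyc \<Xi> (j - 1 + n)"
            unfolding idx xs_def nth_append_length_plus using n
            by (subst segment_nth) (simp_all add: algebra_simps)
          moreover have "xi \<kappa> r q init xs (int t + n) =
              (\<Sum>i = 1..\<kappa>. r i * xi \<kappa> r q init xs (int t + n - int i)) + q (xs ! (nat (int t + n) - 1))"
            using n by (subst xi.simps) simp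
          moreover have "\<eta> (j - 1 + n) =
              (\<Sum>i = 1..\<kappa>. r i * \<eta> (j - 1 + n - int i)) + q (cyc \<Xi> (j - 1 + n))"
            by (rule \<eta>_rec)
          ultimately have "e n = (\<Sum>i = 1..\<kappa>. r i * xi \<kappa> r q init xs (int t + n - int i))
              - (\<Sum>i = 1..\<kappa>. r i * \<eta> (j - 1 + n - int i))"
            unfolding e_def by simp
          also have "\<dots> = (\<Sum>i = 1..\<kappa>. r i * e (n - int i))"
            by (simp add: e_def sum_subtractf right_diff_distrib add_diff_eq)
          finally show ?thesis .
        qed
        show "\<bar>e n\<bar> \<le> 2 * B" if "- int \<kappa> < n" "n \<le> int s" for n
          using bounded[of "int t + n"] \<eta>_le[of "j - 1 + n"] that unfolding e_def by linarith
        have "int \<kappa> * (int k - 1) \<le> int N"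
          by (simp add: N_def algebra_simps)
        then show "int \<kappa> * (int k - 1) < int s"
          using \<open>N < s\<close> by linarith
      qed (use r in auto)
      then show "N < s \<Longrightarrow> \<bar>\<xi> s - \<eta> (j - 1 + int s)\<bar> < \<delta>"
        using k by (simp add: e_def \<xi>_def xs_def)
    qed
    have omega_eq: "omega (change_prob \<Psi> \<kappa> r q init (z @ segment \<Xi> j (int s + j - 1))) = f (\<xi> s)" for s
      using z by (simp add: change_prob_def f_def \<xi>_def length_segment treatments_def)
    define d where "d = block_rate \<Psi> \<kappa> r q \<Xi>"
    have "(\<Sum>n = 1..int l. f (\<eta> n)) = (\<Sum>s<l. f (\<eta> (1 + int s)))"
      by (rule sum.reindex_bij_witness[of _ "\<lambda>s. 1 + int s" "\<lambda>n. nat (n - 1)"]) auto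
    also have "\<dots> = (\<Sum>s<l. f (\<eta> (int s)))"
      by (rule periodic_window_sum) (simp add: \<eta>_per)
    finally have d: "d = (1 / real l) * (\<Sum>s<l. f (\<eta> (int s)))"
      by (simp add: d_def block_rate_def \<Xi>(1) f_def \<eta>_def)
    have "\<bar>(\<Sum>s<M. f (\<xi> (Suc s))) - real M * d\<bar> \<le> real M * (\<epsilon> / 2) + 2 * F * (real N + real l)"
    proof (rule average_near_periodic[where b = "\<lambda>n. f (\<eta> n)" and c = j])
      show "\<bar>f (\<xi> (Suc s)) - f (\<eta> (j + int s))\<bar> \<le> \<epsilon> / 2" if "N \<le> s" for s
        using \<xi>[of "Suc s"] \<eta>_le[of "j + int s"] that
        by (intro less_imp_le \<delta>) (auto simp: abs_le_iff)
      show "\<bar>f (\<xi> (Suc s))\<bar> \<le> F" "\<bar>f (\<eta> n)\<bar> \<le> F" for s n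
        using \<xi>(1)[of "Suc s"] \<eta>_le[of n] by (intro F; simp add: abs_le_iff)+
    qed (use assms(8,10) d in \<open>simp_all add: \<eta>_per\<close>)
    also have "2 * F * (real N + real l) \<le> real M * (\<epsilon> / 2)"
    proof -
      have "2 * (2 * F * (real N + real l)) / \<epsilon> \<le> real M"
        using M1 M by linarith
      then show ?thesis
        using assms(10) by (simp add: field_simps)
    qed
    finally have "\<bar>(\<Sum>s<M. f (\<xi> (Suc s))) - real M * d\<bar> \<le> real M * \<epsilon>"
      by (simp add: field_simps)
    moreover have "(1 / real M) * (\<Sum>s<M. f (\<xi> (Suc s))) - d =
        ((\<Sum>s<M. f (\<xi> (Suc s))) - real M * d) / real M"
      using M by (simp add: field_simps)
    ultimately have "\<bar>(1 / real M) * (\<Sum>s<M. f (\<xi> (Suc s))) - d\<bar> \<le> \<epsilon>"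
      using M by (simp add: abs_divide field_simps)
    then show ?thesis
      by (simp add: omega_eq sum.atLeast1_atMost_eq d_def)
  qed
  show ?thesis
    by (intro exI[of _ "Suc M1"] conjI allI impI SUP_least) (use main in auto)
qed

end
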